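(* Let $(\Omega_1,\mu_1)$ and $(\Omega_2,\mu_2)$ be measure spaces and let $1<p_1,p_2<\infty$. Let $f\colon\Omega_1\times\Omega_2\to\mathbb{R}$ be measurable and such that $$\sup_{E_1\subset\Omega_1,\,E_2\subset\Omega_2}\left\{\int_{E_1\times E_2}|f|\,d\mu_1d\mu_2\,\left(\mu_1(E_1)^{1/p_1'}+\mu_2(E_2)^{1/p_2'}\right)^{-1}\right\}\le1,$$ the supremum being over measurable subsets. Then there is a decomposition $f=f_1+f_2$ with $$\|f_1\|_{L_{p_1,\infty}(\mu_1;L_1(\mu_2))}+\|f_2\|_{L_{p_2,\infty}(\mu_2;L_1(\mu_1))}\le2.$$
   Context: Here $p'$ denotes the conjugate exponent, $\frac1p+\frac1{p'}=1$. The hypothesis is understood as: $\int_{E_1\times E_2}|f|\,d\mu_1d\mu_2\le\mu_1(E_1)^{1/p_1'}+\mu_2(E_2)^{1/p_2'}$ for all measurable $E_1\subset\Omega_1$, $E_2\subset\Omega_2$. For $1<p<\infty$, a measure space $(\Omega,\mu)$ and a Banach space $B$, the norm on $L_{p,\infty}(\mu;B)$ is $\|h\|_{L_{p,\infty}(\mu;B)}=\sup_{E\subset\Omega}\mu(E)^{-1/p'}\int_E\|h\|_B\,d\mu$, with supremum over measurable subsets $E$ (of finite positive measure). Thus, for measurable functions on $\Omega_1\times\Omega_2$, $\|f_1\|_{L_{p_1,\infty}(\mu_1;L_1(\mu_2))}=\sup_{E_1\subset\Omega_1}\mu_1(E_1)^{-1/p_1'}\int_{E_1\times\Omega_2}|f_1|\,d\mu_1d\mu_2$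 and $\|f_2\|_{L_{p_2,\infty}(\mu_2;L_1(\mu_1))}=\sup_{E_2\subset\Omega_2}\mu_2(E_2)^{-1/p_2'}\int_{\Omega_1\times E_2}|f_2|\,d\mu_1d\mu_2$.
   Formalization: Both measure spaces are assumed σ-finite; for arbitrary measure spaces the product measure is not unique and the claim can fail. *)

theory Defs
  imports "HOL-Analysis.Analysis"
begin

definition conj_exp :: "real \<Rightarrow> real" where
  "conj_exp p = p / (p - 1)"

lemma conj_exp_eq: "1 / p + 1 / conj_exp p = 1" if "1 < p"
  using that by (simp add: conj_exp_def field_simps)

(* x^a for 0 < a, with the convention that infinity^a = infinity. *)
definition ennrpow :: "ennreal \<Rightarrow> real \<Rightarrow> ennreal" where
  "ennrpow x a = (if x = \<infinity> then \<infinity> else ennreal (enn2real x powr a))"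

(* The norm of h in L_{p,infinity}(M; B), as a function of the pointwise norm
   N x = \<parallel>h x\<parallel>_B. Sets of measure 0 or infinity do not enter the supremum. *)
definition weak_Lp_norm :: "real \<Rightarrow> 'a measure \<Rightarrow> ('a \<Rightarrow> ennreal) \<Rightarrow> ennreal" where
  "weak_Lp_norm p M N =
     (SUP E \<in> {E \<in> sets M. 0 < emeasure M E \<and> emeasure M E < \<infinity>}.
        ennreal (measure M E powr (- (1 / conj_exp p))) * (\<integral>\<^sup>+x\<in>E. N x \<partial>M))"

definition L1_norm :: "'a measure \<Rightarrow> ('a \<Rightarrow> real) \<Rightarrow> ennreal" where
  "L1_norm M g = (\<integral>\<^sup>+x. ennreal \<bar>g x\<bar> \<partial>M)"

(* L_{p,infinity}(M1; L_1(M2)) and L_{p,infinity}(M2; L_1(M1)) *)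
definition weak_Lp_L1_norm_fst ::
    "real \<Rightarrow> 'a measure \<Rightarrow> 'b measure \<Rightarrow> ('a \<times> 'b \<Rightarrow> real) \<Rightarrow> ennreal" where
  "weak_Lp_L1_norm_fst p M1 M2 f = weak_Lp_norm p M1 (\<lambda>x. L1_norm M2 (\<lambda>y. f (x, y)))"

definition weak_Lp_L1_norm_snd ::
    "real \<Rightarrow> 'a measure \<Rightarrow> 'b measure \<Rightarrow> ('a \<times> 'b \<Rightarrow> real) \<Rightarrow> ennreal" where
  "weak_Lp_L1_norm_snd p M1 M2 f = weak_Lp_norm p M2 (\<lambda>y. L1_norm M1 (\<lambda>x. f (x, y)))"

lemma set_nn_integral_fst_eq:
  assumes "sigma_finite_measure M2"
    and f [measurable]: "f \<in> borel_measurable (M1 \<Otimes>\<^sub>M M2)" and E [measurable]: "E \<in> sets M1"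
  shows "(\<integral>\<^sup>+x\<in>E. L1_norm M2 (\<lambda>y. f (x, y)) \<partial>M1) =
         (\<integral>\<^sup>+z\<in>E \<times> space M2. ennreal \<bar>f z\<bar> \<partial>(M1 \<Otimes>\<^sub>M M2))"
proof -
  interpret M2: sigma_finite_measure M2 by fact
  have "(\<integral>\<^sup>+z\<in>E \<times> space M2. ennreal \<bar>f z\<bar> \<partial>(M1 \<Otimes>\<^sub>M M2)) =
      (\<integral>\<^sup>+x. \<integral>\<^sup>+y. ennreal \<bar>f (x, y)\<bar> * indicator (E \<times> space M2) (x, y) \<partial>M2 \<partial>M1)"
    by (subst M2.nn_integral_fst [symmetric]) auto
  also have "\<dots> = (\<integral>\<^sup>+x. \<integral>\<^sup>+y. ennreal \<bar>f (x, y)\<bar> * indicator E x \<partial>M2 \<partial>M1)"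
    by (intro nn_integral_cong) (auto simp: indicator_def)
  also have "\<dots> = (\<integral>\<^sup>+x\<in>E. L1_norm M2 (\<lambda>y. f (x, y)) \<partial>M1)"
    unfolding L1_norm_def by (intro nn_integral_cong nn_integral_multc) measurable
  finally show ?thesis ..
qed

lemma set_nn_integral_snd_eq:
  assumes "sigma_finite_measure M1" "sigma_finite_measure M2"
    and f [measurable]: "f \<in> borel_measurable (M1 \<Otimes>\<^sub>M M2)" and E [measurable]: "E \<in> sets M2"
  shows "(\<integral>\<^sup>+y\<in>E. L1_norm M1 (\<lambda>x. f (x, y)) \<partial>M2) =
         (\<integral>\<^sup>+z\<in>space M1 \<times> E. ennreal \<bar>f z\<bar> \<partial>(M1 \<Otimes>\<^sub>M M2))"
proof -
  interpret M1: sigma_finite_measure M1 by fact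
  interpret M2: sigma_finite_measure M2 by fact
  interpret P: pair_sigma_finite M1 M2 ..
  have "(\<integral>\<^sup>+z\<in>space M1 \<times> E. ennreal \<bar>f z\<bar> \<partial>(M1 \<Otimes>\<^sub>M M2)) =
      (\<integral>\<^sup>+y. \<integral>\<^sup>+x. ennreal \<bar>f (x, y)\<bar> * indicator (space M1 \<times> E) (x, y) \<partial>M1 \<partial>M2)"
    by (subst P.nn_integral_snd [symmetric]) auto
  also have "\<dots> = (\<integral>\<^sup>+y. \<integral>\<^sup>+x. ennreal \<bar>f (x, y)\<bar> * indicator E y \<partial>M1 \<partial>M2)"
    by (intro nn_integral_cong) (auto simp: indicator_def)
  also have "\<dots> = (\<integral>\<^sup>+y\<in>E. L1_norm M1 (\<lambda>x. f (x, y)) \<partial>M2)"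
    unfolding L1_norm_def by (intro nn_integral_cong nn_integral_multc) measurable
  finally show ?thesis ..
qed

(* The same norms as suprema of integrals over strips of the product space. *)
lemma weak_Lp_L1_norm_fst_eq:
  assumes "sigma_finite_measure M2" "f \<in> borel_measurable (M1 \<Otimes>\<^sub>M M2)"
  shows "weak_Lp_L1_norm_fst p M1 M2 f =
     (SUP E \<in> {E \<in> sets M1. 0 < emeasure M1 E \<and> emeasure M1 E < \<infinity>}.
        ennreal (measure M1 E powr (- (1 / conj_exp p))) *
        (\<integral>\<^sup>+z\<in>E \<times> space M2. ennreal \<bar>f z\<bar> \<partial>(M1 \<Otimes>\<^sub>M M2)))"
  unfolding weak_Lp_L1_norm_fst_def weak_Lp_norm_def
  by (intro SUP_cong refl) (simp add: set_nn_integral_fst_eq [OF assms])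

lemma weak_Lp_L1_norm_snd_eq:
  assumes "sigma_finite_measure M1" "sigma_finite_measure M2"
    "f \<in> borel_measurable (M1 \<Otimes>\<^sub>M M2)"
  shows "weak_Lp_L1_norm_snd p M1 M2 f =
     (SUP E \<in> {E \<in> sets M2. 0 < emeasure M2 E \<and> emeasure M2 E < \<infinity>}.
        ennreal (measure M2 E powr (- (1 / conj_exp p))) *
        (\<integral>\<^sup>+z\<in>space M1 \<times> E. ennreal \<bar>f z\<bar> \<partial>(M1 \<Otimes>\<^sub>M M2)))"
  unfolding weak_Lp_L1_norm_snd_def weak_Lp_norm_def
  by (intro SUP_cong refl) (simp add: set_nn_integral_snd_eq [OF assms])

end

theory Submission
  imports Defs
begin

text \<open>
  Let \<open>L\<close> be the measure with density \<open>\<bar>f\<bar>\<close> with respect to \<open>\<mu>\<^sub>1 \<otimes> \<mu>\<^sub>2\<close>, and let \<open>\<rho> E\<close> and \<open>\<sigma> F\<close> be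
  the powers of \<open>\<mu>\<^sub>1 E\<close> and \<open>\<mu>\<^sub>2 F\<close> in the hypothesis, which then reads \<open>L (E \<times> F) \<le> \<rho> E + \<sigma> F\<close>. The
  decomposition is \<open>f = f w + f (1 - w)\<close> with \<open>0 \<le> w \<le> 1\<close>, where \<open>w\<close> has integral at most \<open>\<rho> E\<close> over
  every strip \<open>E \<times> \<Omega>\<^sub>2\<close> and \<open>1 - w\<close> has integral at most \<open>\<sigma> F\<close> over every strip \<open>\<Omega>\<^sub>1 \<times> F\<close>, both
  with respect to \<open>L\<close>. Each of the two norms is then at most 1. Such a \<open>w\<close> distributes the mass
  of every point over its two coordinates; for finite spaces its existence is a Hall-type theorem
  for polymatroids, with the bound on rectangles as Hall's condition.

  As the exponents lie between 0 and 1, concavity makes \<open>\<rho>\<close> and \<open>\<sigma>\<close> submodular. Let \<open>u\<close> and \<open>v\<close> be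
  nonnegative combinations of indicators on the two spaces, and let \<open>c\<close> and \<open>d\<close> be the same
  combinations of values of \<open>\<rho>\<close> and \<open>\<sigma>\<close>. By submodularity the integral of \<open>\<rho> {u > t}\<close> over
  \<open>t \<ge> 0\<close> is at most \<open>c\<close> (lemma \<open>Choquet_integral_le_price\<close>). The set where \<open>min (u x) (v y) > t\<close> is a
  rectangle, so integration of the hypothesis over \<open>t\<close> gives \<open>\<integral>min u v dL \<le> c + d\<close>
  (lemma \<open>nn_integral_min_le_price\<close>).

  This inequality is the condition under which a sublinear functional on \<open>L\<^sub>1(L)\<close> that encodes all
  the wanted bounds is finite. The Hahn-Banach theorem gives a linear functional \<open>\<phi>\<close> below it
  (lemma \<open>hahn_banach_dominated\<close>). One of the bounds is that \<open>\<phi>\<close> lies between 0 and integration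
  against \<open>L\<close>, hence \<open>\<phi>\<close> has a density \<open>w\<close> with values between 0 and 1
  (lemma \<open>dominated_additive_density\<close>). Theorem \<open>submodular_splitting\<close> combines these steps.
\<close>

section \<open>Linear functionals below a sublinear functional\<close>

text \<open>
  This form of the Hahn-Banach theorem holds because a minimal sublinear functional is linear.
  Zorn's lemma gives a minimal \<open>m\<close> below \<open>p\<close>, since the pointwise infimum of a chain is again
  sublinear. For fixed \<open>h\<close> the functional that sends \<open>g\<close> to the infimum over \<open>t \<ge> 0\<close> of
  \<open>m (g + t h) - t m h\<close> is sublinear and below \<open>m\<close>, hence equal to \<open>m\<close>; its value at \<open>t = 1\<close>
  makes \<open>m\<close> superadditive as well.
\<close>
lemma hahn_banach_dominated:
  fixes V :: "('z \<Rightarrow> real) set" and p :: "('z \<Rightarrow> real) \<Rightarrow> real"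
  assumes zero: "(\<lambda>_. 0) \<in> V"
    and add: "\<And>g h. g \<in> V \<Longrightarrow> h \<in> V \<Longrightarrow> (\<lambda>z. g z + h z) \<in> V"
    and scale: "\<And>c g. g \<in> V \<Longrightarrow> (\<lambda>z. c * g z) \<in> V"
    and p_add: "\<And>g h. g \<in> V \<Longrightarrow> h \<in> V \<Longrightarrow> p (\<lambda>z. g z + h z) \<le> p g + p h"
    and p_scale: "\<And>c g. g \<in> V \<Longrightarrow> 0 \<le> c \<Longrightarrow> p (\<lambda>z. c * g z) = c * p g"
  obtains \<phi> where "\<And>g. g \<in> V \<Longrightarrow> \<phi> g \<le> p g"
    and "\<And>g h. g \<in> V \<Longrightarrow> h \<in> V \<Longrightarrow> \<phi> (\<lambda>z. g z + h z) = \<phi> g + \<phi> h"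
    and "\<And>c g. g \<in> V \<Longrightarrow> \<phi> (\<lambda>z. c * g z) = c * \<phi> g"
proof -
  (* The fixed value outside V keeps every chain in S bounded below at every function. *)
  define S where "S = {q. (\<forall>g. g \<notin> V \<longrightarrow> q g = 0) \<and> (\<forall>g\<in>V. q g \<le> p g) \<and>
      (\<forall>g\<in>V. \<forall>h\<in>V. q (\<lambda>z. g z + h z) \<le> q g + q h) \<and>
      (\<forall>g\<in>V. \<forall>c\<ge>0. q (\<lambda>z. c * g z) = c * (q g :: real))}"
  have S_out: "q g = 0" if "q \<in> S" "g \<notin> V" for q g using that by (simp add: S_def)
  have S_le: "q g \<le> p g" if "q \<in> S" "g \<in> V" for q g using that by (simp add: S_def)
  have S_add: "q (\<lambda>z. g z + h z) \<le> q g + q h" if "q \<in> S" "g \<in> V" "h \<in> V" for q g h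
    using that by (simp add: S_def)
  have S_scale: "q (\<lambda>z. c * g z) = c * q g" if "q \<in> S" "g \<in> V" "0 \<le> c" for q g c
    using that by (simp add: S_def)
  have neg: "(\<lambda>z. - g z) \<in> V" if "g \<in> V" for g using scale[OF that, of "-1"] by simp
  have S_zero: "q (\<lambda>_. 0) = 0" if "q \<in> S" for q using S_scale[OF that zero, of 0] by simp
  have S_neg: "- q (\<lambda>z. - g z) \<le> q g" if "q \<in> S" "g \<in> V" for q g
    using S_add[OF that neg[OF that(2)]] S_zero[OF that(1)] by simp
  have S_lower: "- p (\<lambda>z. - g z) \<le> q g" if "q \<in> S" "g \<in> V" for q g
    using S_neg[OF that] S_le[OF that(1) neg[OF that(2)]] by linarith
  let ?below = "\<lambda>q q'. \<forall>g. q' g \<le> (q g :: real)"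
  have "\<exists>m\<in>S. \<forall>q\<in>S. ?below m q \<longrightarrow> q = m"
  proof (rule predicate_Zorn)
    show "partial_order_on S (relation_of ?below S)"
      by (rule partial_order_on_relation_ofI) (auto intro: order_trans intro!: ext order_antisym)
  next
    fix C assume C: "C \<in> Chains (relation_of ?below S)"
    then have CS: "C \<subseteq> S" and tot: "\<And>q q'. q \<in> C \<Longrightarrow> q' \<in> C \<Longrightarrow> ?below q q' \<or> ?below q' q"
      by (auto simp: Chains_def relation_of_def)
    show "\<exists>u\<in>S. \<forall>q\<in>C. ?below q u"
    proof (cases "C = {}")
      case True
      have "(\<lambda>g. if g \<in> V then p g else 0) \<in> S"
        by (auto simp: S_def add scale p_add p_scale)
      with True show ?thesis by blast
    next
      case False
      define u where "u g = (INF q\<in>C. q g)" for g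
      have bdd: "bdd_below ((\<lambda>q. q g) ` C)" for g
      proof (cases "g \<in> V")
        case True
        then show ?thesis using S_lower CS by (intro bdd_belowI2[of _ "- p (\<lambda>z. - g z)"]) auto
      next
        case F: False
        have "0 \<le> q g" if "q \<in> C" for q
          using S_out[of q g] F CS that by auto
        then show ?thesis by (rule bdd_belowI2)
      qed
      have u_le: "u g \<le> q g" if "q \<in> C" for q g
        unfolding u_def using that by (intro cINF_lower bdd)
      have u_ge: "r \<le> u g" if "\<And>q. q \<in> C \<Longrightarrow> r \<le> q g" for r g
        unfolding u_def using that by (intro cINF_greatest False) auto
      obtain q0 where q0: "q0 \<in> C" using False by blast
      have "u \<in> S"
        unfolding S_def
      proof (intro CollectI conjI ballI allI impI)
        fix g assume g: "g \<notin> V"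
        show "u g = 0"
          using u_le[OF q0, of g] u_ge[of 0 g] S_out CS q0 g by force
      next
        fix g assume "g \<in> V"
        then show "u g \<le> p g" using u_le[OF q0, of g] S_le CS q0 by force
      next
        fix g h assume gh: "g \<in> V" "h \<in> V"
        have "u (\<lambda>z. g z + h z) - q g \<le> u h" if q: "q \<in> C" for q
        proof (rule u_ge)
          fix q' assume q': "q' \<in> C"
          (* The smaller of the two members of the chain serves both arguments. *)
          obtain r where r: "r \<in> C" "r g \<le> q g" "r h \<le> q' h"
            using tot[OF q q'] q q' by blast
          have "u (\<lambda>z. g z + h z) \<le> r g + r h"
            using u_le[OF r(1)] S_add[of r g h] CS r gh by (meson order_trans subsetD)
          with r show "u (\<lambda>z. g z + h z) - q g \<le> q' h" by linarith
        qed
        then have "u (\<lambda>z. g z + h z) - u h \<le> q g" if "q \<in> C" for q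
          using that by (simp add: algebra_simps)
        then have "u (\<lambda>z. g z + h z) - u h \<le> u g"
          by (rule u_ge)
        then show "u (\<lambda>z. g z + h z) \<le> u g + u h" by linarith
      next
        fix g and c :: real assume g: "g \<in> V" and c: "0 \<le> c"
        have *: "q (\<lambda>z. c * g z) = c * q g" if "q \<in> C" for q
          using S_scale that CS g c by blast
        show "u (\<lambda>z. c * g z) = c * u g"
        proof (rule antisym)
          show "c * u g \<le> u (\<lambda>z. c * g z)"
          proof (rule u_ge)
            fix q assume q: "q \<in> C"
            show "c * u g \<le> q (\<lambda>z. c * g z)"
              using mult_left_mono[OF u_le[OF q] c] *[OF q] by simp
          qed
        next
          show "u (\<lambda>z. c * g z) \<le> c * u g"
          proof (cases "c = 0")
            case True
            then show ?thesis using u_le[OF q0] *[OF q0] by (metis mult_zero_left)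
          next
            case F: False
            have "u (\<lambda>z. c * g z) / c \<le> u g"
            proof (rule u_ge)
              fix q assume q: "q \<in> C"
              show "u (\<lambda>z. c * g z) / c \<le> q g"
                using u_le[OF q, of "\<lambda>z. c * g z"] *[OF q] F c by (simp add: divide_le_eq mult.commute)
            qed
            with F c show ?thesis by (simp add: divide_le_eq mult.commute)
          qed
        qed
      qed
      then show ?thesis using u_le by blast
    qed
  qed
  then obtain m where m: "m \<in> S" and m_min: "\<And>q. q \<in> S \<Longrightarrow> ?below m q \<Longrightarrow> q = m" by blast
  have super: "m g + m h \<le> m (\<lambda>z. g z + h z)" if g: "g \<in> V" and h: "h \<in> V" for g h
  proof -
    (* Tilting m in the direction h can only lower it; minimality says that it does not. *)
    define q where "q g = (if g \<in> V then INF t\<in>{0..}. m (\<lambda>z. g z + t * h z) - t * m h else 0)" for g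
    have shift: "(\<lambda>z. g z + t * h z) \<in> V" if "g \<in> V" for g t
      using add[OF that scale[OF h]] .
    have lower: "- m (\<lambda>z. - g z) \<le> m (\<lambda>z. g z + t * h z) - t * m h" if "g \<in> V" "0 \<le> t" for g t
    proof -
      have "m (\<lambda>z. t * h z) \<le> m (\<lambda>z. g z + t * h z) + m (\<lambda>z. - g z)"
        using S_add[OF m shift[OF that(1)] neg[OF that(1)], of t] by simp
      then show ?thesis using S_scale[OF m h that(2)] by simp
    qed
    have q_le: "q g \<le> m (\<lambda>z. g z + t * h z) - t * m h" if "g \<in> V" "0 \<le> t" for g t
      using that lower by (auto simp: q_def intro!: cINF_lower bdd_belowI2)
    have q_ge: "r \<le> q g" if "g \<in> V" "\<And>t. 0 \<le> t \<Longrightarrow> r \<le> m (\<lambda>z. g z + t * h z) - t * m h" for g r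
      using that by (auto simp: q_def intro!: cINF_greatest)
    have q_m: "q g \<le> m g" for g
      using q_le[of g 0] S_out[OF m, of g] by (cases "g \<in> V") (auto simp: q_def)
    have "q \<in> S"
      unfolding S_def
    proof (intro CollectI conjI ballI allI impI)
      fix g assume "g \<notin> V" then show "q g = 0" by (simp add: q_def)
    next
      fix g assume "g \<in> V" then show "q g \<le> p g" using q_m S_le[OF m] order_trans by blast
    next
      fix g k assume gk: "g \<in> V" "k \<in> V"
      have "q (\<lambda>z. g z + k z) - (m (\<lambda>z. g z + s * h z) - s * m h) \<le> q k" if s: "0 \<le> s" for s
      proof (rule q_ge[OF gk(2)])
        fix t :: real assume t: "0 \<le> t"
        have "q (\<lambda>z. g z + k z) \<le> m (\<lambda>z. (g z + k z) + (s + t) * h z) - (s + t) * m h"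
          using q_le[OF add[OF gk], of "s + t"] s t by simp
        also have "(\<lambda>z. (g z + k z) + (s + t) * h z) = (\<lambda>z. (g z + s * h z) + (k z + t * h z))"
          by (simp add: algebra_simps)
        also have "m \<dots> \<le> m (\<lambda>z. g z + s * h z) + m (\<lambda>z. k z + t * h z)"
          by (intro S_add m shift gk)
        finally show "q (\<lambda>z. g z + k z) - (m (\<lambda>z. g z + s * h z) - s * m h)
            \<le> m (\<lambda>z. k z + t * h z) - t * m h" by (simp add: algebra_simps)
      qed
      then have "q (\<lambda>z. g z + k z) - q k \<le> q g"
        by (intro q_ge gk) (simp add: algebra_simps)
      then show "q (\<lambda>z. g z + k z) \<le> q g + q k" by linarith
    next
      fix g and c :: real assume g: "g \<in> V" and c: "0 \<le> c"
      show "q (\<lambda>z. c * g z) = c * q g"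
      proof (cases "c = 0")
        case True
        have "q (\<lambda>_. 0) = 0"
          using q_m[of "\<lambda>_. 0"] q_ge[OF zero, of 0] S_zero[OF m] S_scale[OF m h] by force
        then show ?thesis using True by simp
      next
        case False
        then have c: "0 < c" using c by simp
        have eq: "m (\<lambda>z. c * g z + (c * t) * h z) - c * t * m h
            = c * (m (\<lambda>z. g z + t * h z) - t * m h)" for t
          using S_scale[OF m shift[OF g, of t], of c] c by (simp add: algebra_simps)
        show ?thesis
        proof (rule antisym)
          have "q (\<lambda>z. c * g z) / c \<le> q g"
          proof (rule q_ge[OF g])
            fix t :: real assume "0 \<le> t"
            then show "q (\<lambda>z. c * g z) / c \<le> m (\<lambda>z. g z + t * h z) - t * m h"
              using q_le[OF scale[OF g], of "c * t" c] c eq[of t]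
              by (simp add: divide_le_eq mult.commute)
          qed
          then show "q (\<lambda>z. c * g z) \<le> c * q g" using c by (simp add: divide_le_eq mult.commute)
        next
          show "c * q g \<le> q (\<lambda>z. c * g z)"
          proof (rule q_ge[OF scale[OF g]])
            fix t :: real assume "0 \<le> t"
            then show "c * q g \<le> m (\<lambda>z. c * g z + t * h z) - t * m h"
              using q_le[OF g, of "t / c"] c eq[of "t / c"] by (simp add: mult_left_mono)
          qed
        qed
      qed
    qed
    then have "q = m" using m_min q_m by blast
    then show ?thesis using q_le[OF g, of 1] by simp
  qed
  have m_add: "m (\<lambda>z. g z + h z) = m g + m h" if "g \<in> V" "h \<in> V" for g h
    using super S_add[OF m] that by (simp add: antisym)
  have "m (\<lambda>z. c * g z) = c * m g" if "g \<in> V" for c g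
  proof (cases "0 \<le> c")
    case True then show ?thesis using S_scale[OF m that] by simp
  next
    case False
    have "m (\<lambda>z. c * g z) + m (\<lambda>z. - c * g z) = 0"
      using m_add[OF scale[OF that, of c] scale[OF that, of "- c"]] S_zero[OF m] by simp
    then show ?thesis using False S_scale[OF m that, of "- c"] by simp
  qed
  then show thesis using that m_add S_le[OF m] by blast
qed

section \<open>Densities of dominated additive set functions\<close>

text \<open>
  Domination by a finite measure makes \<open>\<nu>\<close> continuous at the empty set, so \<open>\<nu>\<close> is a measure and
  the Radon-Nikodym theorem applies. No singular part can arise; this is why a functional
  obtained from the Hahn-Banach theorem is as good as a function here.
\<close>
lemma dominated_additive_density_finite:
  fixes L :: "'z measure" and \<nu> :: "'z set \<Rightarrow> real"
  assumes "finite_measure L"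
    and add: "\<And>A B. A \<in> sets L \<Longrightarrow> B \<in> sets L \<Longrightarrow> A \<inter> B = {} \<Longrightarrow> \<nu> (A \<union> B) = \<nu> A + \<nu> B"
    and nonneg: "\<And>A. A \<in> sets L \<Longrightarrow> 0 \<le> \<nu> A"
    and le: "\<And>A. A \<in> sets L \<Longrightarrow> \<nu> A \<le> measure L A"
  obtains w where "w \<in> borel_measurable L" "\<And>z. 0 \<le> w z" "\<And>z. w z \<le> (1::real)"
    "\<And>A. A \<in> sets L \<Longrightarrow> (\<integral>\<^sup>+z\<in>A. ennreal (w z) \<partial>L) = ennreal (\<nu> A)"
proof -
  interpret finite_measure L by fact
  have empty: "\<nu> {} = 0" using nonneg[of "{}"] le[of "{}"] by simp
  define N where "N = measure_of (space L) (sets L) (\<lambda>A. ennreal (\<nu> A))"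
  have pos: "positive (sets L) (\<lambda>A. ennreal (\<nu> A))"
    by (simp add: positive_def empty)
  have "countably_additive (sets L) (\<lambda>A. ennreal (\<nu> A))"
  proof (rule sets.empty_continuous_imp_countably_additive[OF pos])
    show "additive (sets L) (\<lambda>A. ennreal (\<nu> A))"
      by (auto simp: additive_def add nonneg ennreal_plus)
    show "\<forall>A\<in>sets L. ennreal (\<nu> A) \<noteq> \<infinity>" by simp
  next
    fix A :: "nat \<Rightarrow> 'z set" assume A: "range A \<subseteq> sets L" "decseq A" "(\<Inter>i. A i) = {}"
    have "(\<lambda>i. measure L (A i)) \<longlonglongrightarrow> 0"
      using finite_Lim_measure_decseq[OF A(1,2)] A(3) by simp
    then have "(\<lambda>i. \<nu> (A i)) \<longlonglongrightarrow> 0"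
      by (rule tendsto_sandwich[of "\<lambda>_. 0", rotated 3]) (use A(1) nonneg le in \<open>auto intro!: always_eventually\<close>)
    then show "(\<lambda>i. ennreal (\<nu> (A i))) \<longlonglongrightarrow> 0"
      using tendsto_ennrealI by fastforce
  qed
  then have N: "emeasure N A = ennreal (\<nu> A)" if "A \<in> sets L" for A
    using that pos unfolding N_def by (intro emeasure_measure_of_sigma sets.sigma_algebra_axioms)
  have sets_N [simp, measurable_cong]: "sets N = sets L" by (simp add: N_def)
  have space_N: "space N = space L" by (simp add: N_def)
  have "\<nu> A \<le> 0" if "A \<in> null_sets L" for A
    using le[OF null_setsD2[OF that]] measure_eq_0_null_sets[OF that] by simp
  then have ac: "absolutely_continuous L N"
    unfolding absolutely_continuous_def by (auto simp: null_sets_def N ennreal_eq_0_iff)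
  have "finite_measure N"
    by (rule finite_measureI) (simp add: space_N N)
  then obtain g where g [measurable]: "g \<in> borel_measurable L" and gN: "density L g = N"
    using Radon_Nikodym_finite_measure[OF _ sets_N ac] by auto
  have g_int: "(\<integral>\<^sup>+z\<in>A. g z \<partial>L) = ennreal (\<nu> A)" if "A \<in> sets L" for A
    using emeasure_density[OF g that] N[OF that] gN by simp
  (* The density exceeds 1 only on a null set; truncation then gives the bound everywhere. *)
  have "AE z in L. g z \<le> 1"
  proof -
    let ?S = "{z \<in> space L. 1 < g z}"
    have S [measurable]: "?S \<in> sets L" by measurable
    have "(\<integral>\<^sup>+z. (g z - 1) * indicator ?S z \<partial>L)
        = (\<integral>\<^sup>+z. g z * indicator ?S z - indicator ?S z \<partial>L)"
      by (intro nn_integral_cong) (simp split: split_indicator)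
    also have "\<dots> = (\<integral>\<^sup>+z\<in>?S. g z \<partial>L) - (\<integral>\<^sup>+z. indicator ?S z \<partial>L)"
      by (intro nn_integral_diff) (auto split: split_indicator)
    also have "\<dots> = ennreal (\<nu> ?S) - ennreal (measure L ?S)"
      by (simp only: g_int[OF S] nn_integral_indicator[OF S] emeasure_eq_measure)
    also have "\<dots> = 0" using le[OF S] by (simp add: diff_eq_0_iff_ennreal ennreal_leI)
    finally have "AE z in L. (g z - 1) * indicator ?S z = 0"
      by (subst (asm) nn_integral_0_iff_AE) auto
    then show ?thesis
      by (rule AE_mp) (auto intro!: AE_I2 split: split_indicator_asm simp: diff_eq_0_iff_ennreal not_less[symmetric])
  qed
  then have w: "AE z in L. ennreal (enn2real (min 1 (g z))) = g z"
    by (rule AE_mp) (auto intro!: AE_I2 simp: min_absorb2 ennreal_enn2real_if top_unique)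
  show thesis
  proof (rule that)
    show "(\<lambda>z. enn2real (min 1 (g z))) \<in> borel_measurable L" by measurable
    show "0 \<le> enn2real (min 1 (g z))" for z by simp
    show "enn2real (min 1 (g z)) \<le> 1" for z by (rule enn2real_leI) auto
    show "(\<integral>\<^sup>+z\<in>A. ennreal (enn2real (min 1 (g z))) \<partial>L) = ennreal (\<nu> A)" if "A \<in> sets L" for A
      unfolding g_int[OF that, symmetric] using w by (intro nn_integral_cong_AE) auto
  qed
qed

text \<open>
  The densities on the pieces of a countable partition are glued. Domination by \<open>L\<close> is used once
  more to see that \<open>\<nu> A\<close> is the sum of its values on the pieces of \<open>A\<close>.
\<close>
lemma dominated_additive_density:
  fixes L :: "'z measure" and \<nu> :: "'z set \<Rightarrow> real"
  assumes "sigma_finite_measure L"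
    and add: "\<And>A B. A \<in> fmeasurable L \<Longrightarrow> B \<in> fmeasurable L \<Longrightarrow> A \<inter> B = {} \<Longrightarrow>
      \<nu> (A \<union> B) = \<nu> A + \<nu> B"
    and nonneg: "\<And>A. A \<in> fmeasurable L \<Longrightarrow> 0 \<le> \<nu> A"
    and le: "\<And>A. A \<in> fmeasurable L \<Longrightarrow> \<nu> A \<le> measure L A"
  obtains w where "w \<in> borel_measurable L" "\<And>z. 0 \<le> w z" "\<And>z. w z \<le> (1::real)"
    "\<And>A. A \<in> fmeasurable L \<Longrightarrow> (\<integral>\<^sup>+z\<in>A. ennreal (w z) \<partial>L) = ennreal (\<nu> A)"
proof -
  interpret sigma_finite_measure L by fact
  obtain D :: "nat \<Rightarrow> 'z set" where D: "range D \<subseteq> sets L" "(\<Union>i. D i) = space L"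
      "\<And>i. emeasure L (D i) \<noteq> \<infinity>" "disjoint_family D"
    by (rule sigma_finite_disjoint) blast
  have Dm [measurable]: "D i \<in> sets L" for i using D(1) by blast
  have Df: "A \<inter> D i \<in> fmeasurable L" if "A \<in> sets L" for A i
  proof (rule fmeasurableI)
    show "A \<inter> D i \<in> sets L" using that by simp
    have "emeasure L (A \<inter> D i) \<le> emeasure L (D i)" by (rule emeasure_mono) auto
    then show "emeasure L (A \<inter> D i) < \<infinity>" using D(3)[of i] by (simp add: top.not_eq_extremum)
  qed
  have "\<exists>w. w \<in> borel_measurable L \<and> (\<forall>z. 0 \<le> w z \<and> w z \<le> (1::real)) \<and>
      (\<forall>A\<in>sets L. (\<integral>\<^sup>+z\<in>A \<inter> D i. ennreal (w z) \<partial>L) = ennreal (\<nu> (A \<inter> D i)))" for i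
  proof -
    let ?L = "density L (indicator (D i))"
    have em: "emeasure ?L A = emeasure L (A \<inter> D i)" if "A \<in> sets L" for A
      using that emeasure_restricted[OF Dm that] by (simp add: Int_commute)
    have "finite_measure ?L"
      using D(3)[of i] by (intro finite_measureI) (simp add: em)
    then obtain w where w: "w \<in> borel_measurable ?L" "\<And>z. 0 \<le> w z" "\<And>z. w z \<le> (1::real)"
      "\<And>A. A \<in> sets ?L \<Longrightarrow> (\<integral>\<^sup>+z\<in>A. ennreal (w z) \<partial>?L) = ennreal (\<nu> (A \<inter> D i))"
    proof (rule dominated_additive_density_finite[where \<nu> = "\<lambda>A. \<nu> (A \<inter> D i)"])
      fix A B assume "A \<in> sets ?L" "B \<in> sets ?L" "A \<inter> B = {}"
      then show "\<nu> ((A \<union> B) \<inter> D i) = \<nu> (A \<inter> D i) + \<nu> (B \<inter> D i)"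
        using add[OF Df[of A i] Df[of B i]] by (simp add: Int_Un_distrib2 Int_assoc) blast
    next
      fix A assume A: "A \<in> sets ?L"
      then show "0 \<le> \<nu> (A \<inter> D i)" using nonneg Df by simp
      show "\<nu> (A \<inter> D i) \<le> measure ?L A" using A le[OF Df] em by (simp add: measure_def)
    qed blast
    have wm [measurable]: "w \<in> borel_measurable L" using w(1) by simp
    have "(\<integral>\<^sup>+z\<in>A \<inter> D i. ennreal (w z) \<partial>L) = ennreal (\<nu> (A \<inter> D i))" if [measurable]: "A \<in> sets L" for A
    proof -
      have "(\<integral>\<^sup>+z\<in>A \<inter> D i. ennreal (w z) \<partial>L) = (\<integral>\<^sup>+z\<in>A. ennreal (w z) \<partial>?L)"
        by (subst nn_integral_density) (auto intro!: nn_integral_cong split: split_indicator)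
      then show ?thesis using w(4) that by simp
    qed
    then show ?thesis using w(2,3) wm by (intro exI[of _ w]) blast
  qed
  then obtain W where W [measurable]: "\<And>i. W i \<in> borel_measurable L"
    and W01: "\<And>i z. 0 \<le> W i z" "\<And>i z. W i z \<le> (1::real)"
    and W_int: "\<And>i A. A \<in> sets L \<Longrightarrow> (\<integral>\<^sup>+z\<in>A \<inter> D i. ennreal (W i z) \<partial>L) = ennreal (\<nu> (A \<inter> D i))"
    by metis
  define w where "w z = W (LEAST i. z \<in> D i) z" for z
  have [measurable]: "w \<in> borel_measurable L"
    unfolding w_def by (rule measurable_compose_countable[where f = W]) measurable
  have w_eq: "w z = W i z" if "z \<in> D i" for z i
  proof -
    have "z \<in> D (LEAST i. z \<in> D i)" using that by (rule LeastI)
    with that D(4) have "(LEAST i. z \<in> D i) = i" by (auto simp: disjoint_family_on_def)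
    then show ?thesis by (simp add: w_def)
  qed
  have "(\<integral>\<^sup>+z\<in>A. ennreal (w z) \<partial>L) = ennreal (\<nu> A)" if A: "A \<in> fmeasurable L" for A
  proof -
    have [measurable]: "A \<in> sets L" using A by auto
    have AD: "A \<inter> D i \<in> fmeasurable L" for i using Df by simp
    have un: "A \<inter> (\<Union>i<n. D i) \<in> fmeasurable L" for n
      using A by (intro fmeasurable_Int_fmeasurable) auto
    have part: "\<nu> (A \<inter> (\<Union>i<n. D i)) = (\<Sum>i<n. \<nu> (A \<inter> D i))" for n
    proof (induction n)
      case 0
      show ?case using nonneg[of "{}"] le[of "{}"] by simp
    next
      case (Suc n)
      have "A \<inter> (\<Union>i<Suc n. D i) = (A \<inter> (\<Union>i<n. D i)) \<union> (A \<inter> D n)"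
        by (auto simp: less_Suc_eq)
      moreover have "(A \<inter> (\<Union>i<n. D i)) \<inter> (A \<inter> D n) = {}"
      proof -
        have "D i \<inter> D n = {}" if "i < n" for i
          using disjoint_family_onD[OF D(4)] that by simp
        then show ?thesis by blast
      qed
      ultimately show ?case using add[OF un AD] Suc by simp
    qed
    (* The mass of A outside the first n pieces tends to 0. *)
    have inc: "incseq (\<lambda>n. A \<inter> (\<Union>i<n. D i))"
      unfolding incseq_def by (intro allI impI Int_mono UN_mono) auto
    have "(\<Union>n. A \<inter> (\<Union>i<n. D i)) = A \<inter> (\<Union>n. \<Union>i\<in>{0..<n}. D i)"
      unfolding atLeast0LessThan by (rule Int_UN_distrib[symmetric])
    also have "\<dots> = A"
      using sets.sets_into_space[of A L] D(2) by (simp add: UN_UN_finite_eq Int_absorb2)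
    finally have whole: "(\<Union>n. A \<inter> (\<Union>i<n. D i)) = A" .
    have "(\<lambda>n. measure L (A \<inter> (\<Union>i<n. D i))) \<longlonglongrightarrow> measure L (\<Union>n. A \<inter> (\<Union>i<n. D i))"
    proof (rule Lim_measure_incseq[OF _ inc])
      show "range (\<lambda>n. A \<inter> (\<Union>i<n. D i)) \<subseteq> sets L" by auto
      show "emeasure L (\<Union>n. A \<inter> (\<Union>i<n. D i)) \<noteq> \<infinity>"
        unfolding whole using A by (auto simp: fmeasurable_def)
    qed
    then have "(\<lambda>n. measure L (A \<inter> (\<Union>i<n. D i))) \<longlonglongrightarrow> measure L A"
      by (simp only: whole)
    then have lim: "(\<lambda>n. measure L A - measure L (A \<inter> (\<Union>i<n. D i))) \<longlonglongrightarrow> 0"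
      using tendsto_diff[OF tendsto_const[of "measure L A"]] by fastforce
    have "(\<lambda>n. \<nu> A - (\<Sum>i<n. \<nu> (A \<inter> D i))) \<longlonglongrightarrow> 0"
    proof (rule tendsto_sandwich[OF _ _ tendsto_const lim])
      have "\<nu> A - (\<Sum>i<n. \<nu> (A \<inter> D i)) = \<nu> (A - (\<Union>i<n. D i))"
        "measure L A - measure L (A \<inter> (\<Union>i<n. D i)) = measure L (A - (\<Union>i<n. D i))"
        "A - (\<Union>i<n. D i) \<in> fmeasurable L" for n
      proof -
        show df: "A - (\<Union>i<n. D i) \<in> fmeasurable L" using A by (intro fmeasurable_Diff) auto
        have eq: "(A \<inter> (\<Union>i<n. D i)) \<union> (A - (\<Union>i<n. D i)) = A"
          and disj: "(A \<inter> (\<Union>i<n. D i)) \<inter> (A - (\<Union>i<n. D i)) = {}" by blast+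
        have "\<nu> A = \<nu> (A \<inter> (\<Union>i<n. D i)) + \<nu> (A - (\<Union>i<n. D i))"
          using add[OF un df disj] by (simp only: eq)
        then show "\<nu> A - (\<Sum>i<n. \<nu> (A \<inter> D i)) = \<nu> (A - (\<Union>i<n. D i))"
          by (simp add: part)
        have "measure L A = measure L (A \<inter> (\<Union>i<n. D i)) + measure L (A - (\<Union>i<n. D i))"
          using measure_Union[OF _ _ _ _ disj] un[of n] df by (simp add: eq fmeasurable_def)
        then show "measure L A - measure L (A \<inter> (\<Union>i<n. D i)) = measure L (A - (\<Union>i<n. D i))"
          by simp
      qed
      then show "\<forall>\<^sub>F n in sequentially. 0 \<le> \<nu> A - (\<Sum>i<n. \<nu> (A \<inter> D i))"
        "\<forall>\<^sub>F n in sequentially. \<nu> A - (\<Sum>i<n. \<nu> (A \<inter> D i)) \<le> measure L A - measure L (A \<inter> (\<Union>i<n. D i))"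
        using nonneg le by (simp_all add: always_eventually)
    qed
    then have "(\<lambda>n. \<Sum>i<n. \<nu> (A \<inter> D i)) \<longlonglongrightarrow> \<nu> A"
      using tendsto_diff[OF tendsto_const[of "\<nu> A"]] by fastforce
    then have sums: "(\<lambda>i. \<nu> (A \<inter> D i)) sums \<nu> A" by (simp add: sums_def)
    have "(\<integral>\<^sup>+z\<in>A. ennreal (w z) \<partial>L) = (\<integral>\<^sup>+z. (\<Sum>i. ennreal (w z) * indicator (A \<inter> D i) z) \<partial>L)"
    proof (rule nn_integral_cong)
      fix z assume "z \<in> space L"
      have "disjoint_family (\<lambda>i. A \<inter> D i)" using D(4) by (auto simp: disjoint_family_on_def)
      then have "(\<Sum>i. indicator (A \<inter> D i) z) = (indicator (\<Union>i. A \<inter> D i) z :: ennreal)"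
        by (rule suminf_indicator)
      also have "(\<Union>i. A \<inter> D i) = A" using D(2) sets.sets_into_space[of A L] by auto
      finally show "ennreal (w z) * indicator A z = (\<Sum>i. ennreal (w z) * indicator (A \<inter> D i) z)"
        by simp
    qed
    also have "\<dots> = (\<Sum>i. \<integral>\<^sup>+z\<in>A \<inter> D i. ennreal (w z) \<partial>L)"
      by (rule nn_integral_suminf) measurable
    also have "\<dots> = (\<Sum>i. \<integral>\<^sup>+z\<in>A \<inter> D i. ennreal (W i z) \<partial>L)"
      by (intro suminf_cong nn_integral_cong) (auto split: split_indicator simp: w_eq)
    also have "\<dots> = (\<Sum>i. ennreal (\<nu> (A \<inter> D i)))"
      by (simp add: W_int)
    also have "\<dots> = ennreal (\<nu> A)"
      using sums nonneg[OF AD] by (simp add: suminf_ennreal2 sums_iff)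
    finally show ?thesis .
  qed
  then show thesis using W01 by (intro that[of w]) (auto simp: w_def)
qed

section \<open>Prices of step functions\<close>

text \<open>
  The set functions of interest are concave powers of a measure; monotonicity and submodularity
  are what they retain of the power being increasing and concave.
\<close>
locale monotone_submodular =
  fixes M :: "'a measure" and \<rho> :: "'a set \<Rightarrow> real"
  assumes empty: "\<rho> {} = 0"
    and mono: "E \<in> fmeasurable M \<Longrightarrow> F \<in> fmeasurable M \<Longrightarrow> E \<subseteq> F \<Longrightarrow> \<rho> E \<le> \<rho> F"
    and submodular: "E \<in> fmeasurable M \<Longrightarrow> F \<in> fmeasurable M \<Longrightarrow>
      \<rho> (E \<union> F) + \<rho> (E \<inter> F) \<le> \<rho> E + \<rho> F"
begin

text \<open>
  A representation of \<open>u\<close> as a combination of indicators with nonnegative coefficients has as its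
  price the same combination of the values of \<open>\<rho>\<close>. A function can have several prices. Keeping
  all of them, instead of the smallest one, makes the pairs of functions and prices a convex
  cone by construction.
\<close>
inductive priced :: "('a \<Rightarrow> real) \<Rightarrow> real \<Rightarrow> bool" where
  zero: "priced (\<lambda>_. 0) 0"
| step: "priced u c \<Longrightarrow> E \<in> fmeasurable M \<Longrightarrow> 0 \<le> s \<Longrightarrow>
    priced (\<lambda>x. u x + s * indicator E x) (c + s * \<rho> E)"

lemma nonneg: "E \<in> fmeasurable M \<Longrightarrow> 0 \<le> \<rho> E"
  using mono[of "{}" E] empty by simp

lemma priced_indicator: "E \<in> fmeasurable M \<Longrightarrow> priced (indicator E) (\<rho> E)"
  using step[OF zero, of E 1] by simp

lemma priced_add: "priced u c \<Longrightarrow> priced v d \<Longrightarrow> priced (\<lambda>x. u x + v x) (c + d)"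
proof (induction rule: priced.induct)
  case (step u c E s)
  then show ?case using priced.step[OF step.IH[OF step.prems] step.hyps(2,3)] by (simp add: add_ac)
qed simp

lemma priced_scale: "priced u c \<Longrightarrow> 0 \<le> a \<Longrightarrow> priced (\<lambda>x. a * u x) (a * c)"
proof (induction rule: priced.induct)
  case (step u c E s)
  then show ?case using priced.step[OF step.IH[OF step.prems] step.hyps(2), of "a * s"]
    by (simp add: algebra_simps)
qed (simp add: zero)

lemma priced_nonneg: "priced u c \<Longrightarrow> 0 \<le> u x"
  by (induction rule: priced.induct) auto

lemma priced_measurable [measurable_dest]: "priced u c \<Longrightarrow> u \<in> borel_measurable M"
  by (induction rule: priced.induct) auto

lemma superlevel_fmeasurable:
  assumes "priced u c" "0 \<le> t"
  shows "{x \<in> space M. t < u x} \<in> fmeasurable M"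
  using assms
proof (induction arbitrary: t rule: priced.induct)
  case (step u c E s)
  have [measurable]: "u \<in> borel_measurable M" "E \<in> sets M"
    using priced_measurable[OF step.hyps(1)] step.hyps(2) by auto
  have "{x \<in> space M. 0 < u x} \<union> E \<in> fmeasurable M"
    using step by (intro fmeasurable.Un) auto
  then show ?case
  proof (rule fmeasurableI2)
    show "{x \<in> space M. t < u x + s * indicator E x} \<subseteq> {x \<in> space M. 0 < u x} \<union> E"
      using step.prems by (auto split: split_indicator_asm)
  qed measurable
qed simp

lemma measurable_superlevel:
  assumes "priced u c"
  shows "(\<lambda>t. \<rho> {x \<in> space M. max 0 t < u x}) \<in> borel_measurable borel"
proof -
  have "mono (\<lambda>t. - \<rho> {x \<in> space M. max 0 t < u x})"
  proof (rule monoI)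
    fix s t :: real assume "s \<le> t"
    then have "{x \<in> space M. max 0 t < u x} \<subseteq> {x \<in> space M. max 0 s < u x}" by auto
    then show "- \<rho> {x \<in> space M. max 0 s < u x} \<le> - \<rho> {x \<in> space M. max 0 t < u x}"
      using superlevel_fmeasurable[OF assms, of "max 0 s"] superlevel_fmeasurable[OF assms, of "max 0 t"]
      by (auto intro: mono simp del: max_less_iff_conj)
  qed
  from borel_measurable_uminus[OF borel_measurable_mono[OF this]] show ?thesis by simp
qed

lemma measurable_restricted_superlevel:
  assumes "priced u c" and "E \<in> fmeasurable M"
  shows "(\<lambda>t. \<rho> {x \<in> E. t < u x}) \<in> borel_measurable borel"
    and "\<And>t. {x \<in> E. t < u x} \<in> fmeasurable M"
proof -
  have [measurable]: "u \<in> borel_measurable M" "E \<in> sets M"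
    using priced_measurable[OF assms(1)] assms(2) by auto
  show fm: "{x \<in> E. t < u x} \<in> fmeasurable M" for t
  proof (rule fmeasurableI2[OF assms(2)])
    have "{x \<in> E. t < u x} = {x \<in> space M. t < u x} \<inter> E"
      using sets.sets_into_space[of E M] by auto
    then show "{x \<in> E. t < u x} \<in> sets M" by simp
  qed auto
  have "mono (\<lambda>t. - \<rho> {x \<in> E. t < u x})"
    using fm by (intro monoI) (auto intro!: mono)
  from borel_measurable_uminus[OF borel_measurable_mono[OF this]]
  show "(\<lambda>t. \<rho> {x \<in> E. t < u x}) \<in> borel_measurable borel" by simp
qed

text \<open>
  The representation of \<open>u\<close> by its superlevel sets is the cheapest one: its price is the Choquet
  integral of \<open>u\<close>. Let \<open>s \<cdot> 1\<^sub>E\<close> be added to \<open>u\<close>, and put \<open>A = {u > t}\<close> and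
  \<open>B = {x \<in> E. u x > t - s}\<close>. The new superlevel set at \<open>t\<close> is \<open>A \<union> B\<close>, while
  \<open>A \<inter> B = {x \<in> E. u x > t}\<close>. Submodularity compares \<open>\<rho> (A \<union> B) + \<rho> (A \<inter> B)\<close> with \<open>\<rho> A + \<rho> B\<close>.
  When this is integrated over \<open>t \<ge> 0\<close>, the terms for \<open>B\<close> and \<open>A \<inter> B\<close> differ by a shift by \<open>s\<close>,
  and what remains of them is \<open>s \<cdot> \<rho> E\<close>, the increase in price. The maximum with 0 in the
  statement only makes the integrand well behaved for negative \<open>t\<close>, where the superlevel set is
  the whole space.
\<close>
lemma Choquet_integral_le_price:
  assumes "priced u c"
  shows "(\<integral>\<^sup>+t\<in>{0..}. ennreal (\<rho> {x \<in> space M. max 0 t < u x}) \<partial>lborel) \<le> ennreal c" (is "?C u \<le> _")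
    and "0 \<le> c"
  using assms
proof (induction rule: priced.induct)
  case zero
  { case 1 show ?case by (simp add: empty) }
  { case 2 show ?case by simp }
next
  case (step u c E s)
  have E [measurable]: "E \<in> sets M" using step.hyps by auto
  have u [measurable]: "u \<in> borel_measurable M" using priced_measurable[OF step.hyps(1)] .
  have u0: "0 \<le> u x" for x by (rule priced_nonneg[OF step.hyps(1)])
  have EsM: "E \<subseteq> space M" using sets.sets_into_space[OF E] .
  let ?u = "\<lambda>x. u x + s * indicator E x"
  have pu: "priced ?u (c + s * \<rho> E)" by (rule priced.step[OF step.hyps])
  { case 2 show ?case using step.IH(2) step.hyps nonneg by simp }
  { case 1
    define h where "h t = ennreal (\<rho> {x \<in> E. t < u x})" for t
    have h [measurable]: "h \<in> borel_measurable borel"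
      unfolding h_def using measurable_restricted_superlevel(1)[OF step.hyps(1,2)] by measurable
    note superlevel = measurable_superlevel[OF step.hyps(1)] measurable_superlevel[OF pu]
    note [measurable] = superlevel
    (* The integral of h occurs on both sides below and is cancelled at the end. *)
    have fin: "(\<integral>\<^sup>+t\<in>{0..}. h t \<partial>lborel) \<noteq> \<infinity>"
    proof -
      have "(\<integral>\<^sup>+t\<in>{0..}. h t \<partial>lborel) \<le> ?C u"
      proof (rule nn_integral_mono)
        fix t :: real
        show "h t * indicator {0..} t
          \<le> ennreal (\<rho> {x \<in> space M. max 0 t < u x}) * indicator {0..} t"
        proof (cases "0 \<le> t")
          case True
          have "\<rho> {x \<in> E. t < u x} \<le> \<rho> {x \<in> space M. t < u x}"
            using EsM superlevel_fmeasurable[OF step.hyps(1) True]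
              measurable_restricted_superlevel(2)[OF step.hyps(1,2)] by (intro mono) auto
          then show ?thesis using True by (simp add: h_def ennreal_leI max_def)
        qed simp
      qed
      also have "\<dots> < \<infinity>" using step.IH(1) by (simp add: order_le_less_trans)
      finally show ?thesis by simp
    qed
    have "?C ?u + (\<integral>\<^sup>+t\<in>{0..}. h t \<partial>lborel)
        = (\<integral>\<^sup>+t\<in>{0..}. ennreal (\<rho> {x \<in> space M. max 0 t < ?u x}) + h t \<partial>lborel)"
      by (subst nn_integral_add[symmetric]) (auto intro!: nn_integral_cong simp: distrib_right simp del: max_less_iff_conj)
    also have "\<dots> \<le> (\<integral>\<^sup>+t\<in>{0..}. ennreal (\<rho> {x \<in> space M. max 0 t < u x}) + h (t - s) \<partial>lborel)"
    proof (intro nn_integral_mono)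
      fix t :: real
      show "(ennreal (\<rho> {x \<in> space M. max 0 t < ?u x}) + h t) * indicator {0..} t
        \<le> (ennreal (\<rho> {x \<in> space M. max 0 t < u x}) + h (t - s)) * indicator {0..} t"
      proof (cases "0 \<le> t")
        case True
        let ?A = "{x \<in> space M. t < u x}" and ?B = "{x \<in> E. t - s < u x}"
        have A: "?A \<in> fmeasurable M" using superlevel_fmeasurable[OF step.hyps(1) True] .
        have B: "?B \<in> fmeasurable M" using measurable_restricted_superlevel(2)[OF step.hyps(1,2)] .
        have "{x \<in> space M. t < ?u x} = ?A \<union> ?B" "{x \<in> E. t < u x} = ?A \<inter> ?B"
          using EsM step.hyps(3) by (auto split: split_indicator_asm split_indicator)
        then have "\<rho> {x \<in> space M. t < ?u x} + \<rho> {x \<in> E. t < u x} \<le> \<rho> ?A + \<rho> ?B"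
          using submodular[OF A B] by simp
        then have "ennreal (\<rho> {x \<in> space M. t < ?u x}) + h t \<le> ennreal (\<rho> ?A) + h (t - s)"
          unfolding h_def
          using nonneg A B superlevel_fmeasurable[OF pu True]
            measurable_restricted_superlevel(2)[OF step.hyps(1,2)]
          by (simp flip: ennreal_plus add: ennreal_leI)
        then show ?thesis using True by (simp add: max_def)
      qed simp
    qed
    also have "\<dots> = ?C u + (\<integral>\<^sup>+t\<in>{0..}. h (t - s) \<partial>lborel)"
      by (subst nn_integral_add[symmetric]) (auto intro!: nn_integral_cong simp: distrib_right simp del: max_less_iff_conj)
    also have "(\<integral>\<^sup>+t\<in>{0..}. h (t - s) \<partial>lborel) = (\<integral>\<^sup>+t\<in>{-s..}. h t \<partial>lborel)"
      by (subst nn_integral_real_affine[of _ 1 s])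
        (auto intro!: nn_integral_cong split: split_indicator)
    also have "\<dots> = (\<integral>\<^sup>+t\<in>{-s..<0}. h t \<partial>lborel) + (\<integral>\<^sup>+t\<in>{0..}. h t \<partial>lborel)"
      using step.hyps(3)
      by (subst nn_integral_add[symmetric]) (auto intro!: nn_integral_cong split: split_indicator)
    also have "(\<integral>\<^sup>+t\<in>{-s..<0}. h t \<partial>lborel) = (\<integral>\<^sup>+t. ennreal (\<rho> E) * indicator {-s..<0} t \<partial>lborel)"
    proof (rule nn_integral_cong)
      fix t :: real
      have "{x \<in> E. t < u x} = E" if "t < 0" using that u0 by (auto intro: less_le_trans)
      then show "h t * indicator {-s..<0} t = ennreal (\<rho> E) * indicator {-s..<0} t"
        by (simp add: h_def split: split_indicator)
    qed
    also have "\<dots> = ennreal (s * \<rho> E)"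
      using step.hyps(2,3) nonneg by (simp add: nn_integral_cmult ennreal_mult mult.commute)
    finally have "?C ?u + (\<integral>\<^sup>+t\<in>{0..}. h t \<partial>lborel)
        \<le> (?C u + ennreal (s * \<rho> E)) + (\<integral>\<^sup>+t\<in>{0..}. h t \<partial>lborel)" by (simp add: add_ac)
    then have "?C ?u \<le> ?C u + ennreal (s * \<rho> E)"
      using fin ennreal_add_left_cancel_le by (simp add: add.commute[of _ "\<integral>\<^sup>+t\<in>{0..}. h t \<partial>lborel"])
    also have "\<dots> \<le> ennreal c + ennreal (s * \<rho> E)" using step.IH(1) by (simp add: add_right_mono)
    finally show ?case using step.IH(2) step.hyps nonneg by (simp add: ennreal_plus)
  }
qed

end

text \<open>
  The superlevel set of \<open>min (u x) (v y)\<close> at \<open>t\<close> is the rectangle \<open>{u > t} \<times> {v > t}\<close>, so the layer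
  cake formula turns the bound for rectangles into a bound by two Choquet integrals.
\<close>
lemma nn_integral_min_le_price:
  assumes "sigma_finite_measure L" and sets_L: "sets L = sets (M1 \<Otimes>\<^sub>M M2)"
    and "monotone_submodular M1 \<rho>" and "monotone_submodular M2 \<sigma>"
    and rect: "\<And>E F. E \<in> fmeasurable M1 \<Longrightarrow> F \<in> fmeasurable M2 \<Longrightarrow> emeasure L (E \<times> F) \<le> ennreal (\<rho> E + \<sigma> F)"
    and u: "monotone_submodular.priced M1 \<rho> u c" and v: "monotone_submodular.priced M2 \<sigma> v d"
  shows "(\<integral>\<^sup>+z. ennreal (min (u (fst z)) (v (snd z))) \<partial>L) \<le> ennreal (c + d)"
proof -
  interpret R: monotone_submodular M1 \<rho> by fact
  interpret S: monotone_submodular M2 \<sigma> by fact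
  interpret L: sigma_finite_measure L by fact
  interpret P: pair_sigma_finite L lborel ..
  note [measurable_cong] = sets_L
  have [measurable]: "u \<in> borel_measurable M1" "v \<in> borel_measurable M2"
    using R.priced_measurable[OF u] S.priced_measurable[OF v] by auto
  note [measurable] = R.measurable_superlevel[OF u] S.measurable_superlevel[OF v]
  let ?m = "\<lambda>z. min (u (fst z)) (v (snd z))"
  have space_L: "space L = space M1 \<times> space M2"
    using sets_eq_imp_space_eq[OF sets_L] by (simp add: space_pair_measure)
  have "(\<integral>\<^sup>+z. ennreal (?m z) \<partial>L) = (\<integral>\<^sup>+z. \<integral>\<^sup>+t. indicator {0..<?m z} t \<partial>lborel \<partial>L)"
    using R.priced_nonneg[OF u] S.priced_nonneg[OF v] by (intro nn_integral_cong) simp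
  also have "\<dots> = (\<integral>\<^sup>+t. \<integral>\<^sup>+z. indicator {0..<?m z} t \<partial>L \<partial>lborel)"
    by (rule P.Fubini'[symmetric]) (simp add: indicator_def of_bool_def split_beta')
  also have "\<dots> \<le> (\<integral>\<^sup>+t\<in>{0..}. ennreal (\<rho> {x \<in> space M1. max 0 t < u x}) +
      ennreal (\<sigma> {y \<in> space M2. max 0 t < v y}) \<partial>lborel)"
  proof (rule nn_integral_mono)
    fix t :: real
    show "(\<integral>\<^sup>+z. indicator {0..<?m z} t \<partial>L) \<le> (ennreal (\<rho> {x \<in> space M1. max 0 t < u x}) +
      ennreal (\<sigma> {y \<in> space M2. max 0 t < v y})) * indicator {0..} t"
    proof (cases "0 \<le> t")
      case True
      let ?A = "{x \<in> space M1. t < u x}" and ?B = "{y \<in> space M2. t < v y}"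
      note AB = R.superlevel_fmeasurable[OF u True] S.superlevel_fmeasurable[OF v True]
      have [measurable]: "?A \<in> sets M1" "?B \<in> sets M2" by measurable
      have "(\<integral>\<^sup>+z. indicator {0..<?m z} t \<partial>L) = (\<integral>\<^sup>+z. indicator (?A \<times> ?B) z \<partial>L)"
        using True by (intro nn_integral_cong) (auto simp: space_L split: split_indicator)
      also have "\<dots> = emeasure L (?A \<times> ?B)"
        by (intro nn_integral_indicator) (simp add: sets_L)
      also have "\<dots> \<le> ennreal (\<rho> ?A + \<sigma> ?B)" by (rule rect[OF AB])
      also have "\<dots> = ennreal (\<rho> ?A) + ennreal (\<sigma> ?B)"
        using AB R.nonneg S.nonneg by (simp add: ennreal_plus)
      finally show ?thesis using True by (simp add: max_def)
    qed simp
  qed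
  also have "\<dots> = (\<integral>\<^sup>+t\<in>{0..}. ennreal (\<rho> {x \<in> space M1. max 0 t < u x}) \<partial>lborel) +
      (\<integral>\<^sup>+t\<in>{0..}. ennreal (\<sigma> {y \<in> space M2. max 0 t < v y}) \<partial>lborel)"
    by (subst nn_integral_add[symmetric]) (auto intro!: nn_integral_cong simp: distrib_right simp del: max_less_iff_conj)
  also have "\<dots> \<le> ennreal c + ennreal d"
    using R.Choquet_integral_le_price(1)[OF u] S.Choquet_integral_le_price(1)[OF v] by (rule add_mono)
  also have "\<dots> = ennreal (c + d)"
    using R.Choquet_integral_le_price(2)[OF u] S.Choquet_integral_le_price(2)[OF v]
    by (simp add: ennreal_plus)
  finally show ?thesis .
qed

text \<open>
  A strip over a set of finite measure may carry infinite mass. By monotone convergence it is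
  enough to bound the integrals over its subsets of finite mass.
\<close>
lemma set_nn_integral_le_of_fmeasurable_subsets:
  assumes "sigma_finite_measure L" and g [measurable]: "g \<in> borel_measurable L"
    and S [measurable]: "S \<in> sets L"
    and le: "\<And>A. A \<in> fmeasurable L \<Longrightarrow> A \<subseteq> S \<Longrightarrow> (\<integral>\<^sup>+z\<in>A. g z \<partial>L) \<le> c"
  shows "(\<integral>\<^sup>+z\<in>S. g z \<partial>L) \<le> c"
proof -
  interpret sigma_finite_measure L by fact
  obtain B :: "nat \<Rightarrow> 'a set" where B: "range B \<subseteq> sets L" "(\<Union>i. B i) = space L"
      "\<And>i. emeasure L (B i) \<noteq> \<infinity>" "incseq B"
    by (rule sigma_finite_incseq) blast
  have [measurable]: "B i \<in> sets L" for i using B(1) by blast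
  have fm: "S \<inter> B i \<in> fmeasurable L" for i
  proof (rule fmeasurableI)
    have "emeasure L (S \<inter> B i) \<le> emeasure L (B i)" by (rule emeasure_mono) auto
    then show "emeasure L (S \<inter> B i) < \<infinity>" using B(3)[of i] by (simp add: top.not_eq_extremum)
  qed measurable
  have "(\<Union>i. S \<inter> B i) = S" using B(2) sets.sets_into_space[OF S] by auto
  moreover have "incseq (\<lambda>i. S \<inter> B i)" using B(4) by (auto simp: incseq_def)
  ultimately have "(\<integral>\<^sup>+z\<in>S. g z \<partial>L) = (SUP i. emeasure (density L g) (S \<inter> B i))"
    using SUP_emeasure_incseq[of "\<lambda>i. S \<inter> B i" "density L g"]
    by (simp add: image_subset_iff emeasure_density)
  also have "\<dots> \<le> c"
    using le[OF fm] by (intro SUP_least) (simp add: emeasure_density)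
  finally show ?thesis .
qed

section \<open>Splitting a measure on a product\<close>

text \<open>
  The wanted \<open>w\<close> is the density of a functional \<open>\<phi>\<close> on \<open>L\<^sub>1(L)\<close> with two properties: \<open>\<phi> h \<le> c\<close> if
  \<open>h \<le> u\<close> and \<open>u\<close> has price \<open>c\<close>, and \<open>\<integral>h dL - \<phi> h \<le> d\<close> if \<open>h \<le> v\<close> and \<open>v\<close> has price \<open>d\<close>. For
  arbitrary \<open>g\<close> and \<open>h\<close> these would give
  \<open>\<phi> g = \<phi> h + \<phi> (g - h) \<le> c + d - \<integral>(h - g) dL\<close> whenever \<open>h \<le> u\<close> and \<open>h - g \<le> v\<close>. The largest such
  \<open>h\<close> has \<open>h - g = min (u - g) v\<close>. So \<open>\<phi>\<close> has to lie below the infimum \<open>p g\<close> of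
  \<open>c + d - \<integral>min (u - g) v dL\<close>. Conversely, \<open>\<phi> \<le> p\<close> is enough: the choices \<open>g = \<plusminus>1\<^sub>A\<close>, with \<open>u\<close> and \<open>v\<close>
  zero or an indicator, give back all that is needed. Sublinearity of \<open>p\<close> comes from the cone of
  priced functions, and finiteness of \<open>p\<close> is the bound \<open>\<integral>min u v dL \<le> c + d\<close>.
\<close>
theorem submodular_splitting:
  assumes "sigma_finite_measure L" and sets_L: "sets L = sets (M1 \<Otimes>\<^sub>M M2)"
    and "monotone_submodular M1 \<rho>" and "monotone_submodular M2 \<sigma>"
    and rect: "\<And>E F. E \<in> fmeasurable M1 \<Longrightarrow> F \<in> fmeasurable M2 \<Longrightarrow> emeasure L (E \<times> F) \<le> ennreal (\<rho> E + \<sigma> F)"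
  obtains w where "w \<in> borel_measurable L" "\<And>z. 0 \<le> w z" "\<And>z. w z \<le> (1::real)"
    "\<And>E. E \<in> fmeasurable M1 \<Longrightarrow> (\<integral>\<^sup>+z\<in>E \<times> space M2. ennreal (w z) \<partial>L) \<le> ennreal (\<rho> E)"
    "\<And>F. F \<in> fmeasurable M2 \<Longrightarrow> (\<integral>\<^sup>+z\<in>space M1 \<times> F. ennreal (1 - w z) \<partial>L) \<le> ennreal (\<sigma> F)"
proof -
  interpret R: monotone_submodular M1 \<rho> by fact
  interpret S: monotone_submodular M2 \<sigma> by fact
  interpret L: sigma_finite_measure L by fact
  note [measurable_cong] = sets_L
  let ?V = "{g. integrable L g}"
  define gap where "gap u v g z = min (u (fst z) - g z) (v (snd z))"
    for u :: "'a \<Rightarrow> real" and v :: "'b \<Rightarrow> real" and g :: "'a \<times> 'b \<Rightarrow> real" and z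
  have gap: "integrable L (gap u v g)" "(\<integral>z. gap u v g z \<partial>L) \<le> c + d + (\<integral>z. \<bar>g z\<bar> \<partial>L)"
    if u: "R.priced u c" and v: "S.priced v d" and g: "integrable L g" for u c v d g
  proof -
    have [measurable]: "u \<in> borel_measurable M1" "v \<in> borel_measurable M2" "g \<in> borel_measurable L"
      using R.priced_measurable[OF u] S.priced_measurable[OF v] g by auto
    let ?m = "\<lambda>z. min (u (fst z)) (v (snd z))"
    have m0: "0 \<le> ?m z" for z using R.priced_nonneg[OF u] S.priced_nonneg[OF v] by simp
    have le: "(\<integral>\<^sup>+z. ennreal (?m z) \<partial>L) \<le> ennreal (c + d)"
      by (rule nn_integral_min_le_price[OF assms(1-4) rect u v])
    have mi: "integrable L ?m"
      using m0 order_le_less_trans[OF le] by (intro integrableI_nonneg) auto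
    have cd: "0 \<le> c + d"
      using R.Choquet_integral_le_price(2)[OF u] S.Choquet_integral_le_price(2)[OF v] by simp
    have mle: "(\<integral>z. ?m z \<partial>L) \<le> c + d"
      using le m0 cd by (subst (asm) nn_integral_eq_integral[OF mi]) auto
    have close: "\<bar>gap u v g z - ?m z\<bar> \<le> \<bar>g z\<bar>" for z by (simp add: gap_def)
    show gi: "integrable L (gap u v g)"
    proof (rule Bochner_Integration.integrable_bound)
      show "integrable L (\<lambda>z. ?m z + \<bar>g z\<bar>)" using mi g by simp
      show "gap u v g \<in> borel_measurable L" unfolding gap_def by measurable
      show "AE z in L. norm (gap u v g z) \<le> norm (?m z + \<bar>g z\<bar>)"
      proof (rule AE_I2)
        fix z show "norm (gap u v g z) \<le> norm (?m z + \<bar>g z\<bar>)"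
          using close[of z] m0[of z] unfolding real_norm_def by linarith
      qed
    qed
    have "(\<integral>z. gap u v g z \<partial>L) \<le> (\<integral>z. ?m z + \<bar>g z\<bar> \<partial>L)"
    proof (rule integral_mono[OF gi])
      show "integrable L (\<lambda>z. ?m z + \<bar>g z\<bar>)" using mi g by simp
      show "gap u v g z \<le> ?m z + \<bar>g z\<bar>" for z using close[of z] by linarith
    qed
    also have "\<dots> = (\<integral>z. ?m z \<partial>L) + (\<integral>z. \<bar>g z\<bar> \<partial>L)"
      using mi g by simp
    finally show "(\<integral>z. gap u v g z \<partial>L) \<le> c + d + (\<integral>z. \<bar>g z\<bar> \<partial>L)" using mle by linarith
  qed
  define Q where "Q g = {c + d - (\<integral>z. gap u v g z \<partial>L) | u c v d. R.priced u c \<and> S.priced v d}" for g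
  define p where "p g = Inf (Q g)" for g
  have QI: "c + d - (\<integral>z. gap u v g z \<partial>L) \<in> Q g" if "R.priced u c" "S.priced v d" for u c v d g
    using that by (auto simp: Q_def)
  have Q_ne: "Q g \<noteq> {}" for g using QI[OF R.zero S.zero] by blast
  have Q_lower: "- (\<integral>z. \<bar>g z\<bar> \<partial>L) \<le> a" if g: "integrable L g" and a: "a \<in> Q g" for g a
    using a gap(2)[OF _ _ g] by (fastforce simp: Q_def)
  have p_le: "p g \<le> a" if "integrable L g" "a \<in> Q g" for g a
    unfolding p_def using that Q_lower by (intro cInf_lower bdd_belowI) auto
  have p_ge: "r \<le> p g" if "\<And>a. a \<in> Q g \<Longrightarrow> r \<le> a" for g r
    unfolding p_def using that Q_ne by (intro cInf_greatest) auto
  have p_add: "p (\<lambda>z. g z + h z) \<le> p g + p h" if g: "integrable L g" and h: "integrable L h" for g h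
  proof -
    have *: "p (\<lambda>z. g z + h z) \<le> a + b" if a: "a \<in> Q g" and b: "b \<in> Q h" for a b
    proof -
      obtain u c v d where uv: "R.priced u c" "S.priced v d" and a: "a = c + d - (\<integral>z. gap u v g z \<partial>L)"
        using a by (auto simp: Q_def)
      obtain u' c' v' d' where uv': "R.priced u' c'" "S.priced v' d'"
        and b: "b = c' + d' - (\<integral>z. gap u' v' h z \<partial>L)"
        using b by (auto simp: Q_def)
      note sum = R.priced_add[OF uv(1) uv'(1)] S.priced_add[OF uv(2) uv'(2)]
      have gh: "integrable L (\<lambda>z. g z + h z)" using g h by simp
      have "(\<integral>z. gap u v g z \<partial>L) + (\<integral>z. gap u' v' h z \<partial>L) = (\<integral>z. gap u v g z + gap u' v' h z \<partial>L)"
        using gap(1)[OF uv g] gap(1)[OF uv' h] by simp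
      also have "\<dots> \<le> (\<integral>z. gap (\<lambda>x. u x + u' x) (\<lambda>y. v y + v' y) (\<lambda>z. g z + h z) z \<partial>L)"
      proof (rule integral_mono)
        show "integrable L (\<lambda>z. gap u v g z + gap u' v' h z)"
          using gap(1)[OF uv g] gap(1)[OF uv' h] by simp
        show "integrable L (gap (\<lambda>x. u x + u' x) (\<lambda>y. v y + v' y) (\<lambda>z. g z + h z))"
          by (rule gap(1)[OF sum gh])
      qed (auto simp: gap_def)
      finally show ?thesis using p_le[OF gh QI[OF sum]] a b by linarith
    qed
    have "p (\<lambda>z. g z + h z) - b \<le> p g" if "b \<in> Q h" for b
      using *[OF _ that] by (intro p_ge) (simp add: algebra_simps)
    then have "p (\<lambda>z. g z + h z) - p g \<le> p h" by (intro p_ge) (simp add: algebra_simps)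
    then show ?thesis by linarith
  qed
  have p_scale_le: "p (\<lambda>z. a * g z) \<le> a * p g" if g: "integrable L g" and a: "0 < a" for a g
  proof -
    have "p (\<lambda>z. a * g z) / a \<le> p g"
    proof (rule p_ge)
      fix b assume "b \<in> Q g"
      then obtain u c v d where uv: "R.priced u c" "S.priced v d" and b: "b = c + d - (\<integral>z. gap u v g z \<partial>L)"
        by (auto simp: Q_def)
      note auv = R.priced_scale[OF uv(1), of a] S.priced_scale[OF uv(2), of a]
      have "gap (\<lambda>x. a * u x) (\<lambda>y. a * v y) (\<lambda>z. a * g z) z = a * gap u v g z" for z
        using a by (simp add: gap_def min_mult_distrib_left flip: right_diff_distrib)
      then have "a * c + a * d - (\<integral>z. a * gap u v g z \<partial>L) \<in> Q (\<lambda>z. a * g z)"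
        using QI[OF auv, of "\<lambda>z. a * g z"] a by simp
      then have "p (\<lambda>z. a * g z) \<le> a * c + a * d - (\<integral>z. a * gap u v g z \<partial>L)"
        using g by (intro p_le) auto
      then have "p (\<lambda>z. a * g z) \<le> a * b" by (simp add: b algebra_simps)
      then show "p (\<lambda>z. a * g z) / a \<le> b" using a by (simp add: divide_le_eq mult.commute)
    qed
    then show ?thesis using a by (simp add: divide_le_eq mult.commute)
  qed
  have p_zero: "p (\<lambda>_. 0) = 0"
    using p_le[OF _ QI[OF R.zero S.zero], of "\<lambda>_. 0"] p_ge[of "\<lambda>_. 0" 0] Q_lower[of "\<lambda>_. 0"]
    by (force simp: gap_def)
  have p_scale: "p (\<lambda>z. a * g z) = a * p g" if g: "integrable L g" and a: "0 \<le> a" for a g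
  proof (cases "a = 0")
    case False
    then have a: "0 < a" using a by simp
    (* The reverse inequality is the one already shown, for the factor 1 / a. *)
    have "p (\<lambda>z. (1 / a) * (a * g z)) \<le> (1 / a) * p (\<lambda>z. a * g z)"
      using g a by (intro p_scale_le) auto
    then have "a * p g \<le> p (\<lambda>z. a * g z)" using a by (simp add: field_simps)
    then show ?thesis using p_scale_le[OF g a] by simp
  qed (simp add: p_zero)
  obtain \<phi> where \<phi>_le: "\<And>g. g \<in> ?V \<Longrightarrow> \<phi> g \<le> p g"
    and \<phi>_add: "\<And>g h. g \<in> ?V \<Longrightarrow> h \<in> ?V \<Longrightarrow> \<phi> (\<lambda>z. g z + h z) = \<phi> g + \<phi> h"
    and \<phi>_scale: "\<And>a g. g \<in> ?V \<Longrightarrow> \<phi> (\<lambda>z. a * g z) = a * \<phi> g"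
  proof (rule hahn_banach_dominated[of ?V p])
    fix g h :: "'a \<times> 'b \<Rightarrow> real" assume "g \<in> ?V" "h \<in> ?V"
    then show "(\<lambda>z. g z + h z) \<in> ?V" "p (\<lambda>z. g z + h z) \<le> p g + p h"
      using p_add by auto
  next
    fix g :: "'a \<times> 'b \<Rightarrow> real" and a :: real assume "g \<in> ?V"
    then show "(\<lambda>z. a * g z) \<in> ?V" "0 \<le> a \<Longrightarrow> p (\<lambda>z. a * g z) = a * p g"
      using p_scale by auto
  qed auto
  define \<nu> where "\<nu> A = \<phi> (indicator A)" for A :: "('a \<times> 'b) set"
  have ind: "integrable L (indicator A :: _ \<Rightarrow> real)" "integrable L (\<lambda>z. - indicator A z :: real)"
    if "A \<in> fmeasurable L" for A
    using that by (auto simp: fmeasurable_def)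
  have \<nu>_upper: "\<nu> A \<le> c + d - (\<integral>z. gap u v (indicator A) z \<partial>L)"
    if "A \<in> fmeasurable L" "R.priced u c" "S.priced v d" for A u c v d
    using \<phi>_le[of "indicator A"] p_le[OF ind(1) QI] that ind by (fastforce simp: \<nu>_def)
  have \<nu>_lower: "- \<nu> A \<le> c + d - (\<integral>z. gap u v (\<lambda>z. - indicator A z) z \<partial>L)"
    if A: "A \<in> fmeasurable L" and uv: "R.priced u c" "S.priced v d" for A u c v d
    using \<phi>_le[of "\<lambda>z. - indicator A z"] p_le[OF ind(2) QI, OF A uv] \<phi>_scale[of "indicator A" "-1"] ind[OF A]
    by (simp add: \<nu>_def)
  have measure_int: "(\<integral>z. indicator A z \<partial>L) = measure L A" if "A \<in> fmeasurable L" for A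
    using that by simp
  have \<nu>_nonneg: "0 \<le> \<nu> A" if "A \<in> fmeasurable L" for A
  proof -
    have "gap (\<lambda>_. 0) (\<lambda>_. 0) (\<lambda>z. - indicator A z) z = 0" for z
      by (simp add: gap_def split: split_indicator)
    then show ?thesis using \<nu>_lower[OF that R.zero S.zero] by simp
  qed
  have \<nu>_measure: "\<nu> A \<le> measure L A" if "A \<in> fmeasurable L" for A
  proof -
    have "gap (\<lambda>_. 0) (\<lambda>_. 0) (indicator A) z = - indicator A z" for z
      by (simp add: gap_def split: split_indicator)
    then show ?thesis using \<nu>_upper[OF that R.zero S.zero] measure_int[OF that] by simp
  qed
  have \<nu>_\<rho>: "\<nu> A \<le> \<rho> E" if A: "A \<in> fmeasurable L" and E: "E \<in> fmeasurable M1" and "A \<subseteq> E \<times> space M2" for A E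
  proof -
    (* With u the indicator of E the cost is the value of rho at E, and nothing is gained back. *)
    have "gap (indicator E) (\<lambda>_. 0) (indicator A) z = 0" for z
      using \<open>A \<subseteq> _\<close> by (auto simp: gap_def split: split_indicator)
    then show ?thesis using \<nu>_upper[OF A R.priced_indicator[OF E] S.zero] by simp
  qed
  have \<nu>_\<sigma>: "measure L A - \<nu> A \<le> \<sigma> F" if A: "A \<in> fmeasurable L" and F: "F \<in> fmeasurable M2" and "A \<subseteq> space M1 \<times> F" for A F
  proof -
    (* Here v is the indicator of F, and the gain is all of A. *)
    have "gap (\<lambda>_. 0) (indicator F) (\<lambda>z. - indicator A z) z = indicator A z" for z
      using \<open>A \<subseteq> _\<close> by (auto simp: gap_def split: split_indicator)
    then show ?thesis using \<nu>_lower[OF A R.zero S.priced_indicator[OF F]] measure_int[OF A] by simp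
  qed
  have \<nu>_add: "\<nu> (A \<union> B) = \<nu> A + \<nu> B"
    if AB: "A \<in> fmeasurable L" "B \<in> fmeasurable L" "A \<inter> B = {}" for A B
  proof -
    have "(indicator (A \<union> B) :: _ \<Rightarrow> real) = (\<lambda>z. indicator A z + indicator B z)"
      using AB(3) by (auto intro!: ext split: split_indicator)
    then show ?thesis using \<phi>_add ind(1) AB by (simp add: \<nu>_def)
  qed
  obtain w where w [measurable]: "w \<in> borel_measurable L" and w01: "\<And>z. 0 \<le> w z" "\<And>z. w z \<le> (1::real)"
    and w_int: "\<And>A. A \<in> fmeasurable L \<Longrightarrow> (\<integral>\<^sup>+z\<in>A. ennreal (w z) \<partial>L) = ennreal (\<nu> A)"
    using dominated_additive_density[OF assms(1) \<nu>_add \<nu>_nonneg \<nu>_measure] by blast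
  have w'_int: "(\<integral>\<^sup>+z\<in>A. ennreal (1 - w z) \<partial>L) = ennreal (measure L A - \<nu> A)" if A: "A \<in> fmeasurable L" for A
  proof -
    have [measurable]: "A \<in> sets L" using A by auto
    have "ennreal (\<nu> A) + (\<integral>\<^sup>+z\<in>A. ennreal (1 - w z) \<partial>L)
        = (\<integral>\<^sup>+z\<in>A. ennreal (w z) \<partial>L) + (\<integral>\<^sup>+z\<in>A. ennreal (1 - w z) \<partial>L)"
      by (simp only: w_int[OF A])
    also have "\<dots> = (\<integral>\<^sup>+z. indicator A z \<partial>L)"
    proof -
      have "ennreal (w z) * indicator A z + ennreal (1 - w z) * indicator A z = indicator A z" for z
        using w01[of z] by (simp flip: ennreal_plus split: split_indicator)
      then show ?thesis by (subst nn_integral_add[symmetric]) auto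
    qed
    also have "\<dots> = ennreal (\<nu> A + (measure L A - \<nu> A))"
      using A by (simp add: emeasure_eq_measure2)
    also have "\<dots> = ennreal (\<nu> A) + ennreal (measure L A - \<nu> A)"
      using \<nu>_nonneg[OF A] \<nu>_measure[OF A] by (intro ennreal_plus) auto
    finally show ?thesis by (simp add: ennreal_add_left_cancel)
  qed
  show thesis
  proof (rule that[OF w w01])
    fix E assume E: "E \<in> fmeasurable M1"
    show "(\<integral>\<^sup>+z\<in>E \<times> space M2. ennreal (w z) \<partial>L) \<le> ennreal (\<rho> E)"
    proof (rule set_nn_integral_le_of_fmeasurable_subsets[OF assms(1)])
      show "E \<times> space M2 \<in> sets L" using E by (auto simp: sets_L)
      fix A assume "A \<in> fmeasurable L" "A \<subseteq> E \<times> space M2"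
      then show "(\<integral>\<^sup>+z\<in>A. ennreal (w z) \<partial>L) \<le> ennreal (\<rho> E)"
        using w_int[of A] \<nu>_\<rho>[OF _ E, of A] by (simp add: ennreal_leI)
    qed measurable
  next
    fix F assume F: "F \<in> fmeasurable M2"
    show "(\<integral>\<^sup>+z\<in>space M1 \<times> F. ennreal (1 - w z) \<partial>L) \<le> ennreal (\<sigma> F)"
    proof (rule set_nn_integral_le_of_fmeasurable_subsets[OF assms(1)])
      show "space M1 \<times> F \<in> sets L" using F by (auto simp: sets_L)
      fix A assume "A \<in> fmeasurable L" "A \<subseteq> space M1 \<times> F"
      then show "(\<integral>\<^sup>+z\<in>A. ennreal (1 - w z) \<partial>L) \<le> ennreal (\<sigma> F)"
        using w'_int[of A] \<nu>_\<sigma>[OF _ F, of A] by (simp add: ennreal_leI)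
    qed measurable
  qed
qed

section \<open>Powers of a measure and the weak norm\<close>

lemma powr_increment_antimono:
  fixes x y z a :: real
  assumes "0 < a" "a \<le> 1" "0 \<le> x" "0 \<le> y" "0 \<le> z"
  shows "(x + y + z) powr a + x powr a \<le> (x + y) powr a + (x + z) powr a"
proof -
  let ?f = "\<lambda>r. (r + z) powr a - r powr a"
  have "?f (x + y) \<le> ?f x"
  proof (rule DERIV_nonpos_imp_decreasing_open[where f = ?f])
    fix r assume r: "x < r" "r < x + y"
    then have "DERIV ?f r :> a * (r + z) powr (a - 1) - a * r powr (a - 1)"
      using assms by (auto intro!: derivative_eq_intros)
    moreover have "(r + z) powr (a - 1) \<le> r powr (a - 1)"
      using r assms by (intro powr_mono2') auto
    ultimately show "\<exists>D. DERIV ?f r :> D \<and> D \<le> 0"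
      using assms by (intro exI conjI) (auto intro: mult_left_mono)
  next
    show "continuous_on {x..x + y} ?f"
      using assms by (intro continuous_intros continuous_on_powr') auto
  qed (use assms in auto)
  then show ?thesis by (simp add: add_ac)
qed

text \<open>
  By concavity, enlarging \<open>E \<inter> F\<close> to \<open>F\<close> raises the power of the measure at least as much as
  enlarging \<open>E\<close> to \<open>E \<union> F\<close>, because the same mass is added to a smaller set.
\<close>
lemma submodular_measure_powr:
  assumes "0 < a" "a \<le> (1::real)"
  shows "monotone_submodular M (\<lambda>E. measure M E powr a)"
proof
  fix E F assume E: "E \<in> fmeasurable M" and F: "F \<in> fmeasurable M"
  show "measure M (E \<union> F) powr a + measure M (E \<inter> F) powr a \<le> measure M E powr a + measure M F powr a"
  proof -
    have disjoint_union: "measure M (A \<union> B) = measure M A + measure M B"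
      if "A \<in> fmeasurable M" "B \<in> fmeasurable M" "A \<inter> B = {}" for A B
      using that by (intro measure_Union) (auto simp: fmeasurable_def)
    have EF: "E \<inter> F \<in> fmeasurable M" "E - F \<in> fmeasurable M" "F - E \<in> fmeasurable M"
      using E F by (auto intro: fmeasurable_Diff)
    have "measure M ((E \<inter> F) \<union> (E - F)) = measure M (E \<inter> F) + measure M (E - F)"
      using EF by (intro disjoint_union) auto
    moreover have "measure M ((E \<inter> F) \<union> (F - E)) = measure M (E \<inter> F) + measure M (F - E)"
      using EF by (intro disjoint_union) auto
    moreover have "measure M (E \<union> (F - E)) = measure M E + measure M (F - E)"
      using E EF by (intro disjoint_union) auto
    moreover have "(E \<inter> F) \<union> (E - F) = E" "(E \<inter> F) \<union> (F - E) = F" "E \<union> (F - E) = E \<union> F"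
      by blast+
    ultimately show ?thesis
      using powr_increment_antimono[of a "measure M (E \<inter> F)" "measure M (E - F)" "measure M (F - E)"] assms
      by simp
  qed
next
  fix E F assume "E \<in> fmeasurable M" "F \<in> fmeasurable M" "E \<subseteq> F"
  then show "measure M E powr a \<le> measure M F powr a"
    using assms by (intro powr_mono2 measure_mono_fmeasurable) auto
qed (use assms in simp)

lemma inverse_conj_exp_bounds:
  assumes "1 < p"
  shows "0 < 1 / conj_exp p" "1 / conj_exp p \<le> 1"
  using assms by (auto simp: conj_exp_def field_simps)

lemma SUP_normalized_le_one:
  assumes "\<And>E. E \<in> fmeasurable M \<Longrightarrow> I E \<le> ennreal (measure M E powr a)"
  shows "(SUP E \<in> {E \<in> sets M. 0 < emeasure M E \<and> emeasure M E < \<infinity>}.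
     ennreal (measure M E powr (- a)) * I E) \<le> 1"
proof (rule SUP_least)
  fix E assume "E \<in> {E \<in> sets M. 0 < emeasure M E \<and> emeasure M E < \<infinity>}"
  then have E: "E \<in> fmeasurable M" and pos: "0 < measure M E"
    by (auto simp: fmeasurable_def measure_def enn2real_positive_iff)
  have "ennreal (measure M E powr (- a)) * I E
      \<le> ennreal (measure M E powr (- a)) * ennreal (measure M E powr a)"
    by (intro mult_left_mono assms E) simp
  also have "\<dots> = ennreal (measure M E powr (- a) * measure M E powr a)"
    by (simp add: ennreal_mult)
  also have "\<dots> = 1" using pos by (simp flip: powr_add)
  finally show "ennreal (measure M E powr (- a)) * I E \<le> 1" .
qed

section \<open>The decomposition\<close>

theorem lemma3:
  fixes M1 :: "'a measure" and M2 :: "'b measure" and p1 p2 :: real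
    and f :: "'a \<times> 'b \<Rightarrow> real"
  assumes "sigma_finite_measure M1" and "sigma_finite_measure M2"
    and "1 < p1" and "1 < p2"
    and "f \<in> borel_measurable (M1 \<Otimes>\<^sub>M M2)"
    and "\<And>E1 E2. E1 \<in> sets M1 \<Longrightarrow> E2 \<in> sets M2 \<Longrightarrow>
      (\<integral>\<^sup>+z\<in>E1 \<times> E2. ennreal \<bar>f z\<bar> \<partial>(M1 \<Otimes>\<^sub>M M2))
        \<le> ennrpow (emeasure M1 E1) (1 / conj_exp p1) + ennrpow (emeasure M2 E2) (1 / conj_exp p2)"
  shows "\<exists>f1 f2. f1 \<in> borel_measurable (M1 \<Otimes>\<^sub>M M2) \<and> f2 \<in> borel_measurable (M1 \<Otimes>\<^sub>M M2) \<and>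
    (\<forall>z \<in> space (M1 \<Otimes>\<^sub>M M2). f z = f1 z + f2 z) \<and>
    weak_Lp_L1_norm_fst p1 M1 M2 f1 + weak_Lp_L1_norm_snd p2 M1 M2 f2 \<le> 2"
proof -
  interpret M1: sigma_finite_measure M1 by fact
  interpret M2: sigma_finite_measure M2 by fact
  interpret P: pair_sigma_finite M1 M2 ..
  note f [measurable] = assms(5)
  let ?a = "1 / conj_exp p1" and ?b = "1 / conj_exp p2"
  define L where "L = density (M1 \<Otimes>\<^sub>M M2) (\<lambda>z. ennreal \<bar>f z\<bar>)"
  have sets_L [measurable_cong]: "sets L = sets (M1 \<Otimes>\<^sub>M M2)" by (simp add: L_def)
  have "sigma_finite_measure L"
    unfolding L_def by (subst P.sigma_finite_iff_density_finite) auto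
  moreover have "emeasure L (E \<times> F) \<le> ennreal (measure M1 E powr ?a + measure M2 F powr ?b)"
    if E: "E \<in> fmeasurable M1" and F: "F \<in> fmeasurable M2" for E F
  proof -
    have [measurable]: "E \<in> sets M1" "F \<in> sets M2" using E F by auto
    have "emeasure L (E \<times> F) = (\<integral>\<^sup>+z\<in>E \<times> F. ennreal \<bar>f z\<bar> \<partial>(M1 \<Otimes>\<^sub>M M2))"
      unfolding L_def by (subst emeasure_density) auto
    also have "\<dots> \<le> ennrpow (emeasure M1 E) ?a + ennrpow (emeasure M2 F) ?b"
      by (rule assms(6)) auto
    also have "\<dots> = ennreal (measure M1 E powr ?a + measure M2 F powr ?b)"
      using E F by (auto simp: ennrpow_def measure_def fmeasurable_def)
    finally show ?thesis .
  qed
  ultimately obtain w where w: "w \<in> borel_measurable L" and w01: "\<And>z. 0 \<le> w z" "\<And>z. w z \<le> (1::real)"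
    and w1: "\<And>E. E \<in> fmeasurable M1 \<Longrightarrow>
      (\<integral>\<^sup>+z\<in>E \<times> space M2. ennreal (w z) \<partial>L) \<le> ennreal (measure M1 E powr ?a)"
    and w2: "\<And>F. F \<in> fmeasurable M2 \<Longrightarrow>
      (\<integral>\<^sup>+z\<in>space M1 \<times> F. ennreal (1 - w z) \<partial>L) \<le> ennreal (measure M2 F powr ?b)"
    using submodular_splitting[OF _ sets_L submodular_measure_powr[OF inverse_conj_exp_bounds[OF assms(3)]]
      submodular_measure_powr[OF inverse_conj_exp_bounds[OF assms(4)]]] by blast
  have wm [measurable]: "w \<in> borel_measurable (M1 \<Otimes>\<^sub>M M2)"
    using w measurable_cong_sets[OF sets_L refl] by blast
  let ?f1 = "\<lambda>z. f z * w z" and ?f2 = "\<lambda>z. f z * (1 - w z)"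
  (* |f| is the density of L, so the strip integrals of f1 and f2 are those of w and 1 - w against L. *)
  have transfer: "(\<integral>\<^sup>+z\<in>S. ennreal \<bar>f z * v z\<bar> \<partial>(M1 \<Otimes>\<^sub>M M2)) = (\<integral>\<^sup>+z\<in>S. ennreal (v z) \<partial>L)"
    if [measurable]: "S \<in> sets (M1 \<Otimes>\<^sub>M M2)" "v \<in> borel_measurable (M1 \<Otimes>\<^sub>M M2)"
      and v: "\<And>z. 0 \<le> v z" for S v
    unfolding L_def using v
    by (subst nn_integral_density) (auto intro!: nn_integral_cong simp: abs_mult ennreal_mult mult.assoc)
  have "weak_Lp_L1_norm_fst p1 M1 M2 ?f1 \<le> 1"
  proof -
    have "?f1 \<in> borel_measurable (M1 \<Otimes>\<^sub>M M2)" by measurable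
    show ?thesis
      unfolding weak_Lp_L1_norm_fst_eq[OF assms(2) \<open>?f1 \<in> _\<close>]
      by (intro SUP_normalized_le_one) (use w1 w01 in \<open>auto simp: transfer\<close>)
  qed
  moreover have "weak_Lp_L1_norm_snd p2 M1 M2 ?f2 \<le> 1"
  proof -
    have "?f2 \<in> borel_measurable (M1 \<Otimes>\<^sub>M M2)" by measurable
    show ?thesis
      unfolding weak_Lp_L1_norm_snd_eq[OF assms(1,2) \<open>?f2 \<in> _\<close>]
      by (intro SUP_normalized_le_one) (use w2 w01 in \<open>auto simp: transfer\<close>)
  qed
  ultimately have "weak_Lp_L1_norm_fst p1 M1 M2 ?f1 + weak_Lp_L1_norm_snd p2 M1 M2 ?f2 \<le> 1 + 1"
    by (rule add_mono)
  then show ?thesis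
    by (intro exI[of _ ?f1] exI[of _ ?f2]) (auto simp: algebra_simps)
qed

end
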